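(* Let $n$ be a positive integer, let $\mu_1,\ldots,\mu_n\ge0$ and let $t>\sum_{i=1}^n\mu_i$ with $t>0$. Then $$V:=\inf_{f\in\mathcal{Z}_{ic}(t)}\ \sup_{X_i\in\mathcal{U}(\mu_i)}\ \mathbb{E}\left[f\left(\sum_{i=1}^nX_i\right)\right]\ \ge\ \frac{\sum_{i=1}^n\mu_i}{t},$$ where the supremum is over all independent random variables $X_1,\ldots,X_n$ with $X_i\in\mathcal{U}(\mu_i)$ for $i=1,\ldots,n$.
   Context: $\mathcal{U}(\mu)=\{X: X\ge0,\ \mathbb{E}[X]=\mu\}$ is the class of non-negative random variables with mean $\mu$. For $t>0$, $\mathcal{F}_{ic}(t)$ is the set of all convex functions $f:[0,\infty)\to[0,\infty)$ that are increasing (in the sense of nondecreasing) on $[t,\infty)$, and $\mathcal{Z}_{ic}(t)$ is the set of all $f\in\mathcal{F}_{ic}(t)$ such that $f(t)=1$. Expectations may equal $+\infty$. *)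

theory Defs
  imports "HOL-Probability.Probability"
begin

definition F_ic :: "real \<Rightarrow> (real \<Rightarrow> real) set" where
  \<comment> \<open>A function \<open>[0,\<infinity>) \<rightarrow> [0,\<infinity>)\<close> is a total function whose values on \<open>(-\<infinity>,0)\<close> are
     unconstrained; they are never used below.\<close>
  "F_ic t = {f. (\<forall>x\<ge>0. 0 \<le> f x) \<and> convex_on {0..} f \<and> mono_on {t..} f}"

definition Z_ic :: "real \<Rightarrow> (real \<Rightarrow> real) set" where
  "Z_ic t = {f \<in> F_ic t. f t = 1}"

definition U_class :: "'a measure \<Rightarrow> real \<Rightarrow> ('a \<Rightarrow> real) set" where
  "U_class M \<mu> = {X. integrable M X \<and> (\<forall>\<omega>\<in>space M. 0 \<le> X \<omega>) \<and> integral\<^sup>L M X = \<mu>}"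

text \<open>All choices of a probability space on the type \<^typ>\<open>'a\<close> together with independent
  random variables \<open>X\<^sub>1, \<dots>, X\<^sub>n\<close> on it, \<open>X\<^sub>i\<close> having mean \<open>\<mu>\<^sub>i\<close>.\<close>

definition indep_U :: "nat \<Rightarrow> (nat \<Rightarrow> real) \<Rightarrow> ('a measure \<times> (nat \<Rightarrow> 'a \<Rightarrow> real)) set" where
  "indep_U n \<mu> = {(M, X). prob_space M \<and> prob_space.indep_vars M (\<lambda>_. borel) X {1..n} \<and>
     (\<forall>i\<in>{1..n}. X i \<in> U_class M (\<mu> i))}"

text \<open>The supremum ranges over all probability spaces with sample type \<^typ>\<open>nat \<Rightarrow> real\<close>
  (arbitrary underlying set, sigma-algebra and measure). A supremum over all types cannot be
  written in HOL, and none is needed: by \<open>nn_integral_le_sup_E\<close> below, random variables on an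
  arbitrary probability space do not give a larger value. Expectations are taken in
  \<^typ>\<open>ennreal\<close>, so they may be infinite.\<close>

definition sup_E :: "nat \<Rightarrow> (nat \<Rightarrow> real) \<Rightarrow> (real \<Rightarrow> real) \<Rightarrow> ennreal" where
  "sup_E n \<mu> f = (SUP (M, X) \<in> (indep_U n \<mu> :: ((nat \<Rightarrow> real) measure \<times> _) set).
     \<integral>\<^sup>+\<omega>. ennreal (f (\<Sum>i=1..n. X i \<omega>)) \<partial>M)"

definition V :: "real \<Rightarrow> nat \<Rightarrow> (nat \<Rightarrow> real) \<Rightarrow> ennreal" where
  "V t n \<mu> = (INF f \<in> Z_ic t. sup_E n \<mu> f)"

lemma F_ic_measurable:
  assumes "f \<in> F_ic t"
  shows "(\<lambda>x. f (max 0 x)) \<in> borel_measurable borel"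
proof -
  have "convex_on {0<..} f"
    using assms by (auto simp: F_ic_def intro: convex_on_subset)
  then have c: "continuous_on {0<..} f"
    by (intro convex_on_continuous) auto
  have "(\<lambda>x. if x \<in> {0<..} then f x else f 0) \<in> borel_measurable borel"
    by (rule borel_measurable_continuous_on_if) (use c in auto)
  also have "(\<lambda>x. if x \<in> {0<..} then f x else f 0) = (\<lambda>x. f (max 0 x))"
    by (auto simp: max_def fun_eq_iff)
  finally show ?thesis .
qed

lemma nn_integral_le_sup_E:
  fixes M :: "'a measure"
  assumes MX: "(M, X) \<in> indep_U n \<mu>" and f: "f \<in> F_ic t" and n: "n \<ge> 1"
  shows "(\<integral>\<^sup>+\<omega>. ennreal (f (\<Sum>i=1..n. X i \<omega>)) \<partial>M) \<le> sup_E n \<mu> f"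
proof -
  interpret prob_space M using MX by (simp add: indep_U_def)
  define I where "I = {1..n}"
  define P where "P = (\<Pi>\<^sub>M i\<in>I. (borel :: real measure))"
  define Z where "Z = (\<lambda>\<omega>. \<lambda>i\<in>I. X i \<omega>)"
  define N where "N = distr M P Z"
  define Y where "Y = (\<lambda>i (v :: nat \<Rightarrow> real). max 0 (v i))"
  have I: "I \<noteq> {}" using n by (auto simp: I_def)
  have ind: "indep_vars (\<lambda>_. borel) X I"
    using MX by (simp add: indep_U_def I_def)
  have U: "integrable M (X i)" "\<And>\<omega>. \<omega> \<in> space M \<Longrightarrow> 0 \<le> X i \<omega>" "integral\<^sup>L M (X i) = \<mu> i"
    if "i \<in> I" for i
    using MX that by (auto simp: indep_U_def I_def U_class_def)
  have mX [measurable]: "X i \<in> borel_measurable M" if "i \<in> I" for i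
    using U(1)[OF that] by simp
  have mZ [measurable]: "Z \<in> measurable M P"
    unfolding Z_def P_def by (intro measurable_restrict) simp
  have mY [measurable]: "Y i \<in> borel_measurable P" if "i \<in> I" for i
    unfolding Y_def P_def using that by measurable
  have YZ: "Y i (Z \<omega>) = X i \<omega>" if "i \<in> I" "\<omega> \<in> space M" for i \<omega>
    using that U(2) by (simp add: Y_def Z_def)
  have N: "prob_space N" unfolding N_def by (rule prob_space_distr) simp
  have mYN: "Y i \<in> borel_measurable N" if "i \<in> I" for i
    using mY[OF that] by (simp add: N_def)
  have dY: "distr N borel (Y i) = distr M borel (X i)" if "i \<in> I" for i
    unfolding N_def using that by (subst distr_distr) (auto intro!: distr_cong simp: YZ)
  have mYr: "(\<lambda>v. \<lambda>i\<in>I. Y i v) \<in> measurable P P"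
    unfolding P_def by (intro measurable_restrict) (use mY in \<open>simp add: P_def\<close>)
  have "distr N P (\<lambda>v. \<lambda>i\<in>I. Y i v) = distr M P (\<lambda>\<omega>. \<lambda>i\<in>I. X i \<omega>)"
    unfolding N_def using mYr mZ
    by (subst distr_distr) (auto intro!: distr_cong simp: YZ cong: restrict_cong)
  also have "\<dots> = (\<Pi>\<^sub>M i\<in>I. distr M borel (X i))"
    unfolding P_def using indep_vars_iff_distr_eq_PiM'[where X = X, OF I mX] ind by simp
  also have "\<dots> = (\<Pi>\<^sub>M i\<in>I. distr N borel (Y i))"
    by (intro PiM_cong) (auto simp: dY)
  finally have "prob_space.indep_vars N (\<lambda>_. borel) Y I"
    using prob_space.indep_vars_iff_distr_eq_PiM'[where X = Y, OF N I mYN] unfolding P_def by simp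
  moreover have "Y i \<in> U_class N (\<mu> i)" if "i \<in> I" for i
  proof -
    have "integrable N (Y i)"
      unfolding N_def using that U(1)[OF that] YZ[OF that]
      by (subst integrable_distr_eq) (auto cong: Bochner_Integration.integrable_cong)
    moreover have "integral\<^sup>L N (Y i) = \<mu> i"
      unfolding N_def using that U(3)[OF that] YZ[OF that]
      by (subst integral_distr) (auto cong: Bochner_Integration.integral_cong)
    ultimately show ?thesis by (auto simp: U_class_def Y_def)
  qed
  ultimately have NY: "(N, Y) \<in> indep_U n \<mu>"
    using N by (auto simp: indep_U_def I_def)
  have "(\<lambda>v. f (max 0 (\<Sum>i\<in>I. Y i v))) \<in> borel_measurable P"
    by (rule measurable_compose[OF _ F_ic_measurable[OF f]]) (intro borel_measurable_sum mY)
  moreover have "max 0 (\<Sum>i\<in>I. Y i v) = (\<Sum>i\<in>I. Y i v)" for v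
    by (intro max_absorb2 sum_nonneg) (simp add: Y_def)
  ultimately have mf: "(\<lambda>v. ennreal (f (\<Sum>i\<in>I. Y i v))) \<in> borel_measurable P"
    by simp
  have "(\<integral>\<^sup>+\<omega>. ennreal (f (\<Sum>i\<in>I. X i \<omega>)) \<partial>M) = (\<integral>\<^sup>+\<omega>. ennreal (f (\<Sum>i\<in>I. Y i (Z \<omega>))) \<partial>M)"
    by (intro nn_integral_cong) (simp add: YZ)
  also have "\<dots> = (\<integral>\<^sup>+v. ennreal (f (\<Sum>i\<in>I. Y i v)) \<partial>N)"
    unfolding N_def using mf by (subst nn_integral_distr) auto
  also have "\<dots> \<le> sup_E n \<mu> f"
    unfolding sup_E_def I_def by (rule SUP_upper2[OF NY]) simp
  finally show ?thesis by (simp add: I_def)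
qed

end

theory Submission
  imports Defs
begin

text \<open>
  One family of random variables serves every admissible \<open>f\<close>: let \<open>X\<^sub>i\<close> take the value \<open>t\<close> with
  probability \<open>\<mu>\<^sub>i / t\<close> and the value \<open>0\<close> otherwise. Then \<open>S = \<Sum>X\<^sub>i\<close> lies in
  \<open>{0} \<union> [t, \<infinity>)\<close>, so it avoids the open interval \<open>(0, t)\<close>, the only part of \<open>[0, \<infinity>)\<close> where a
  convex function may lie below its secant line through \<open>0\<close> and \<open>t\<close>
  (\<open>convex_above_secant\<close>). For \<open>f t = 1\<close> this reads \<open>f S \<ge> f 0 + (1 - f 0) * S / t\<close>.
  The right-hand side is affine in \<open>S\<close>, so with \<open>m = \<Sum>\<mu>\<^sub>i\<close> its expectation is
  \<open>f 0 + (1 - f 0) * m / t = m / t + f 0 * (1 - m / t)\<close>, and this is at least \<open>m / t\<close>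
  because \<open>f 0 \<ge> 0\<close> and \<open>m < t\<close>.
\<close>

lemma convex_above_secant:
  fixes f :: "real \<Rightarrow> real"
  assumes f: "convex_on {0..} f" and t: "0 < t" and x: "x = 0 \<or> t \<le> x"
  shows "f 0 + (f t - f 0) * (x / t) \<le> f x"
proof (cases "x = 0")
  case False
  then have tx: "0 < x" "t \<le> x" using x t by auto
  \<comment> \<open>The point \<open>t\<close> lies between \<open>0\<close> and \<open>x\<close>; the convexity inequality there, solved for \<open>f x\<close>,
     is the claim.\<close>
  have "f ((1 - t / x) *\<^sub>R 0 + (t / x) *\<^sub>R x) \<le> (1 - t / x) * f 0 + (t / x) * f x"
    by (rule convex_onD[OF f]) (use t tx in auto)
  then have "f t \<le> (1 - t / x) * f 0 + (t / x) * f x" using tx by simp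
  then have "f t - f 0 \<le> (t / x) * (f x - f 0)" by (simp add: algebra_simps)
  then have "(f t - f 0) * (x / t) \<le> ((t / x) * (f x - f 0)) * (x / t)"
    by (rule mult_right_mono) (use t tx in auto)
  also have "\<dots> = f x - f 0" using t tx by simp
  finally show ?thesis by simp
qed simp

text \<open>The independent variables \<open>X\<^sub>i\<close> live on a product of Bernoulli spaces. Its finite support
  makes every function on it integrable.\<close>

lemma two_point_in_indep_U:
  fixes n :: nat and \<mu> :: "nat \<Rightarrow> real" and t :: real
  assumes \<mu>: "\<And>i. i \<in> {1..n} \<Longrightarrow> 0 \<le> \<mu> i \<and> \<mu> i \<le> t" and t: "0 < t"
  defines "P \<equiv> Pi_pmf {1..n} False (\<lambda>i. bernoulli_pmf (\<mu> i / t))"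
  shows "(measure_pmf P, \<lambda>i \<omega>. if \<omega> i then t else 0) \<in> indep_U n \<mu>"
    and "finite (set_pmf P)"
proof -
  show fin: "finite (set_pmf P)"
    unfolding P_def by (rule finite_subset[OF set_Pi_pmf_subset']) (auto intro: finite_PiE_dflt)
  have "prob_space.indep_vars (measure_pmf P) (\<lambda>_. borel)
      (\<lambda>i \<omega>. if \<omega> i then t else 0) {1..n}"
    unfolding P_def
    by (rule prob_space.indep_vars_compose2[OF _ indep_vars_Pi_pmf, where Y = "\<lambda>_ b. if b then t else 0"])
       (auto intro: measure_pmf.prob_space_axioms)
  moreover have "(\<lambda>\<omega>. if \<omega> i then t else 0) \<in> U_class (measure_pmf P) (\<mu> i)"
    if i: "i \<in> {1..n}" for i
  proof -
    have "measure_pmf.expectation P (\<lambda>\<omega>. if \<omega> i then t else 0) =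
        measure_pmf.expectation (map_pmf (\<lambda>\<omega>. \<omega> i) P) (\<lambda>b. if b then t else 0)"
      by simp
    also have "map_pmf (\<lambda>\<omega>. \<omega> i) P = bernoulli_pmf (\<mu> i / t)"
      unfolding P_def using i by (simp add: Pi_pmf_component)
    also have "measure_pmf.expectation \<dots> (\<lambda>b. if b then t else 0) = \<mu> i"
      using \<mu>[OF i] t by simp
    finally show ?thesis
      using t fin by (auto simp: U_class_def intro: integrable_measure_pmf_finite)
  qed
  ultimately show "(measure_pmf P, \<lambda>i \<omega>. if \<omega> i then t else 0) \<in> indep_U n \<mu>"
    by (auto simp: indep_U_def measure_pmf.prob_space_axioms)
qed

lemma sup_E_lower_bound:
  fixes n :: nat and \<mu> :: "nat \<Rightarrow> real" and t :: real
  assumes n: "n \<ge> 1"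
    and \<mu>: "\<And>i. i \<in> {1..n} \<Longrightarrow> \<mu> i \<ge> 0"
    and m: "(\<Sum>i=1..n. \<mu> i) < t"
    and t: "0 < t"
    and f: "f \<in> Z_ic t"
  shows "ennreal ((\<Sum>i=1..n. \<mu> i) / t) \<le> sup_E n \<mu> f"
proof -
  define P where "P = Pi_pmf {1..n} False (\<lambda>i. bernoulli_pmf (\<mu> i / t))"
  define X where "X = (\<lambda>(i :: nat) \<omega>. if \<omega> i then t else (0 :: real))"
  define S where "S = (\<lambda>\<omega>. \<Sum>i=1..n. X i \<omega>)"
  have \<mu>_le: "\<mu> i \<le> t" if "i \<in> {1..n}" for i
    using member_le_sum[of i "{1..n}" \<mu>] that \<mu> m by fastforce
  then have U: "(measure_pmf P, X) \<in> indep_U n \<mu>" and fin: "finite (set_pmf P)"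
    using two_point_in_indep_U[of n \<mu> t] \<mu> t unfolding P_def X_def by auto
  have int: "integrable (measure_pmf P) (g :: _ \<Rightarrow> real)" for g
    by (rule integrable_measure_pmf_finite[OF fin])
  have EX: "measure_pmf.expectation P (X i) = \<mu> i" if "i \<in> {1..n}" for i
    using U that by (auto simp: indep_U_def U_class_def)
  have ES: "measure_pmf.expectation P S = (\<Sum>i=1..n. \<mu> i)"
    unfolding S_def using EX by (subst Bochner_Integration.integral_sum) (auto intro: int)
  have S_values: "S \<omega> = 0 \<or> t \<le> S \<omega>" for \<omega>
  proof (cases "\<exists>i\<in>{1..n}. \<omega> i")
    case True
    then obtain i where i: "i \<in> {1..n}" "\<omega> i" by blast
    then have "X i \<omega> \<le> S \<omega>"
      unfolding S_def by (intro member_le_sum) (use t in \<open>auto simp: X_def\<close>)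
    then show ?thesis using i by (simp add: X_def)
  qed (simp add: S_def X_def)
  have S_nonneg: "0 \<le> S \<omega>" for \<omega>
    using S_values[of \<omega>] t by auto
  have f_nonneg: "\<And>x. 0 \<le> x \<Longrightarrow> 0 \<le> f x" and f_conv: "convex_on {0..} f" and ft: "f t = 1"
    and f_ic: "f \<in> F_ic t"
    using f by (auto simp: Z_ic_def F_ic_def)
  let ?m = "\<Sum>i=1..n. \<mu> i"
  have "?m / t \<le> ?m / t + f 0 * (1 - ?m / t)"
    using f_nonneg[of 0] m t by simp
  also have "\<dots> = f 0 + (1 - f 0) * (?m / t)"
    by (simp add: algebra_simps diff_divide_distrib)
  also have "\<dots> = measure_pmf.expectation P (\<lambda>\<omega>. f 0 + (1 - f 0) * (S \<omega> / t))"
    by (subst Bochner_Integration.integral_add[OF int int]) (simp add: ES)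
  also have "\<dots> \<le> measure_pmf.expectation P (\<lambda>\<omega>. f (S \<omega>))"
    by (intro integral_mono int)
       (use convex_above_secant[OF f_conv t S_values] ft in simp)
  finally have "ennreal (?m / t) \<le> ennreal (measure_pmf.expectation P (\<lambda>\<omega>. f (S \<omega>)))"
    by (rule ennreal_leI)
  also have "\<dots> = (\<integral>\<^sup>+\<omega>. ennreal (f (S \<omega>)) \<partial>measure_pmf P)"
    by (subst nn_integral_eq_integral[OF int]) (auto intro: f_nonneg S_nonneg)
  also have "\<dots> \<le> sup_E n \<mu> f"
    unfolding S_def by (rule nn_integral_le_sup_E[OF U f_ic n])
  finally show ?thesis .
qed

theorem proposition6p1:
  fixes n :: nat and \<mu> :: "nat \<Rightarrow> real" and t :: real
  assumes "n \<ge> 1"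
    and "\<And>i. i \<in> {1..n} \<Longrightarrow> \<mu> i \<ge> 0"
    and "t > (\<Sum>i=1..n. \<mu> i)"
    and "t > 0"
  shows "V t n \<mu> \<ge> ennreal ((\<Sum>i=1..n. \<mu> i) / t)"
  unfolding V_def by (rule INF_greatest) (rule sup_E_lower_bound[OF assms])

end
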